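(* Let $g \geq 2$ be an integer. There is $N_0 = N_0(g)$ such that for all $N \geq N_0$, every $B_3[g]$-set $A \subseteq [N]$ satisfies \[ |A| < (14.3\, g N)^{1/3}. \]
   Context: $[N] = \{1,2,\dots,N\}$. For positive integers $h,g$, a set $A \subseteq [N]$ is a $B_h[g]$-set if for every integer $n$ there are at most $g$ distinct multisets $\{a_1,\dots,a_h\}$ of size $h$ with all $a_i \in A$ and $a_1 + \dots + a_h = n$. *)

theory Defs
  imports Complex_Main "HOL-Library.Multiset"
begin

text \<open>A is a B_h[g]-set: for every integer n, at most g distinct multisets of size h
  with elements from A have sum n. (Sums of natural numbers are natural, so negative
  targets have no representations and need not be considered.)\<close>
definition Bhg_set :: "nat \<Rightarrow> nat \<Rightarrow> nat set \<Rightarrow> bool" where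
  "Bhg_set h g A \<longleftrightarrow>
     (\<forall>n::nat. card {M :: nat multiset. set_mset M \<subseteq> A \<and> size M = h \<and> sum_mset M = n} \<le> g)"

end

theory Submission
  imports Defs
begin

text \<open>Place the elements of \<open>A\<close> at angles in \<open>[-\<pi>/3, \<pi>/3]\<close>, so that sums of three elements fill the
  circle exactly once. Each sum has at most \<open>6g\<close> ordered representations, so every trigonometric
  polynomial \<open>w = 1 + Re (\<Sum> u\<^sub>k e\<^bsup>ikx\<^esup>) \<ge> 0\<close> of degree at most 3 yields
  \<open>|A|\<^sup>3 (1 + Re (\<Sum> u\<^sub>k \<phi>\<^sub>k\<^sup>3)) \<le> 18gN\<close>, where \<open>\<phi>\<^sub>k\<close> is the mean of \<open>e\<^bsup>ikX\<^esup>\<close> over \<open>A\<close>. It remains to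
  find \<open>w\<close> with gain \<open>Re (\<Sum> u\<^sub>k \<phi>\<^sub>k\<^sup>3)\<close> at least \<open>0.2588 > 18/14.3 - 1\<close>. If \<open>|\<phi>\<^sub>1|\<close> or \<open>|\<phi>\<^sub>3|\<close> is at least \<open>0.6373\<close>,
  a single frequency suffices. Otherwise, since \<open>cos 3X \<le> 4 cos X - 3\<close> on the arc, the mass is
  confined to the neighbourhood of \<open>0\<close> and \<open>\<plusminus>\<pi>/3\<close>, which pins down \<open>\<phi>\<^sub>1, \<phi>\<^sub>2, \<phi>\<^sub>3\<close> well enough for one fixed
  kernel (or its reflection) to give the gain.\<close>

section \<open>Polynomial inequalities\<close>

text \<open>The left side is the tangent line of the cube at \<open>y\<close>, and the difference
  has a double root there. It turns cubes into linear bounds at hand-picked points.\<close>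

lemma cube_ge_tangent:
  fixes x y :: real
  assumes "0 \<le> x" "0 \<le> y"
  shows "3 * y\<^sup>2 * x - 2 * y ^ 3 \<le> x ^ 3"
proof -
  have "0 \<le> (x - y)\<^sup>2 * (x + 2 * y)" using assms by simp
  also have "\<dots> = x ^ 3 - 3 * y\<^sup>2 * x + 2 * y ^ 3" by algebra
  finally show ?thesis by linarith
qed

text \<open>The right side is the real part of \<open>(b + iv)^3\<close>. The disc bound on
  \<open>v\<^sup>2\<close> serves when \<open>b\<close> is large, the Cauchy-Schwarz bound when
  \<open>b\<close> is small; the split is along a line in \<open>r\<close> and
  \<open>b\<close>.\<close>

lemma third_moment_bound:
  fixes r b v :: real
  assumes "3 - 4 * r \<le> b" "r \<le> 6373/10000" "b \<le> 6373/10000" "b\<^sup>2 + v\<^sup>2 \<le> (6373/10000)\<^sup>2"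
    and "v\<^sup>2 \<le> 18/5 * (2 * r - 1) * (4 * r - 3 + b)"
  shows "348/100 - 11/2 * r \<le> b ^ 3 - 3 * b * v\<^sup>2"
proof -
  have b: "b \<ge> 45/100" and r: "r \<ge> 59/100" using assms by linarith+
  show ?thesis
  proof (cases "164/100 - 17/10 * r \<le> b")
    case True
    have "b * (b\<^sup>2 + v\<^sup>2) \<le> b * (6373/10000)\<^sup>2" using assms(4) b by (intro mult_left_mono) auto
    moreover have "b * (b\<^sup>2 + v\<^sup>2) = b ^ 3 + b * v\<^sup>2" by algebra
    moreover have "108/100 * b - 432/1000 \<le> b ^ 3"
      using cube_ge_tangent[of b "6/10"] b by (simp add: power2_eq_square power3_eq_cube)
    ultimately show ?thesis using True r by (simp add: power2_eq_square)
  next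
    case False
    \<comment> \<open>Since \<open>r\<close> is at most 0.6373, the factor
      \<open>18/5 * (2 * r - 1)\<close> is below 1.\<close>
    have "(18/5 * (2 * r - 1)) * (4 * r - 3 + b) \<le> 1 * (4 * r - 3 + b)"
      using assms by (intro mult_right_mono) auto
    then have "v\<^sup>2 \<le> 4 * r - 3 + b" using order_trans[OF assms(5)] by simp
    then have "b * v\<^sup>2 \<le> b * (4 * r - 3 + b)" using b by (intro mult_left_mono) auto
    moreover have "b * (4 * r - 3 + b) = 4 * (b * r) - 3 * b + b\<^sup>2" by algebra
    moreover have "12 * (b * r) - 11/2 * r \<le> b ^ 3 - 3 * b\<^sup>2 + 9 * b - 348/100"
    \<comment> \<open>The left side is linear in \<open>r\<close> with slope
      \<open>12 * b - 11/2\<close>. For a nonnegative slope the negated case supplies an upper bound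
      on \<open>r\<close>; for a negative one the left side is at most 0.\<close>
    proof (cases "11/2 \<le> 12 * b")
      case True
      have "17/10 * r * (12 * b - 11/2) \<le> (164/100 - b) * (12 * b - 11/2)"
        using True False by (intro mult_right_mono) auto
      moreover have "17/10 * r * (12 * b - 11/2) = 17/10 * (12 * (b * r) - 11/2 * r)" by algebra
      moreover have "(164/100 - b) * (12 * b - 11/2) = 2518/100 * b - 12 * b\<^sup>2 - 902/100"
        by (simp add: algebra_simps power2_eq_square)
      moreover have "0 \<le> (b - 588/1000)\<^sup>2" by simp
      then have "1176/1000 * b - 345744/1000000 \<le> b\<^sup>2"
        by (simp add: algebra_simps power2_eq_square)
      moreover have "1037232/1000000 * b - 406594944/1000000000 \<le> b ^ 3"
        using cube_ge_tangent[of b "588/1000"] b by (simp add: power2_eq_square power3_eq_cube)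
      ultimately show ?thesis using assms(3) by argo
    next
      case False
      then have "r * (12 * b - 11/2) \<le> 0" using r by (intro mult_nonneg_nonpos) auto
      moreover have "r * (12 * b - 11/2) = 12 * (b * r) - 11/2 * r" by algebra
      moreover have "b * b \<le> b * (11/24)" using b False by (intro mult_left_mono) auto
      moreover have "6075/10000 * b - 18225/100000 \<le> b ^ 3"
        using cube_ge_tangent[of b "45/100"] b by (simp add: power2_eq_square power3_eq_cube)
      ultimately show ?thesis using b unfolding power2_eq_square by linarith
    qed
    ultimately show ?thesis by linarith
  qed
qed

text \<open>Inserting the bounds for \<open>p\<close>, \<open>q\<close>, \<open>i\<close> and
  \<open>g\<close> leaves a convex quadratic in \<open>r\<close>. On the interval for
  \<open>r\<close> it lies below its chord, which is what the product of the two endpoint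
  differences expresses.\<close>

lemma second_moment_bound:
  fixes r i p q g :: real
  assumes "5906/10000 \<le> r" "r \<le> 6373/10000" "r\<^sup>2 + i\<^sup>2 \<le> (6373/10000)\<^sup>2"
    and "0 \<le> g" "g \<le> 4 * r - 23627/10000"
    and "3 * r - 2 - g / 4 \<le> p" "p \<le> 3 * r - 2"
    and "(q - i)\<^sup>2 \<le> 2/5 * (2 * r - 1) * g"
  shows "p\<^sup>2 + q\<^sup>2 \<le> (38/100)\<^sup>2"
proof -
  \<comment> \<open>1.4094 is 2 - 2.3627/4 rounded up, from the bound on \<open>g\<close>.\<close>
  have "\<bar>p\<bar> \<le> \<bar>14094/10000 - 2 * r\<bar>" using assms by linarith
  then have "p\<^sup>2 \<le> (14094/10000 - 2 * r)\<^sup>2" by (simp only: abs_le_square_iff)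
  moreover have "(14094/10000 - 2 * r)\<^sup>2 = (14094/10000)\<^sup>2 - 4 * (14094/10000) * r + 4 * r\<^sup>2"
    by algebra
  \<comment> \<open>Equivalent to
    \<open>q\<^sup>2 \<le> 3/2 * i\<^sup>2 + 3 * (q - i)\<^sup>2\<close>.\<close>
  moreover have "0 \<le> (2 * q - 3 * i)\<^sup>2" by simp
  moreover have "(2 * q - 3 * i)\<^sup>2 = 3 * i\<^sup>2 + 6 * (q - i)\<^sup>2 - 2 * q\<^sup>2" by algebra
  moreover have "(2/5 * (2 * r - 1)) * g \<le> (2/5 * (2 * r - 1)) * (4 * r - 23627/10000)"
    using assms by (intro mult_left_mono) auto
  moreover have "(2/5 * (2 * r - 1)) * (4 * r - 23627/10000)
      = 16/5 * r\<^sup>2 - (8/5 + 4/5 * (23627/10000)) * r + 2/5 * (23627/10000)"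
    by (simp add: field_simps power2_eq_square)
  moreover have "(r - 5906/10000) * (r - 6373/10000) \<le> 0"
    using assms by (intro mult_nonneg_nonpos) auto
  moreover have "(r - 5906/10000) * (r - 6373/10000)
      = r\<^sup>2 - 12279/10000 * r + 5906/10000 * (6373/10000)"
    by (simp add: field_simps power2_eq_square)
  moreover have "(14094/10000)\<^sup>2 = (14094 * 14094 / 100000000 :: real)"
      "(6373/10000)\<^sup>2 = (6373 * 6373 / 100000000 :: real)" "(38/100)\<^sup>2 = (1444/10000::real)"
    by (simp_all add: power2_eq_square)
  ultimately show ?thesis using assms by argo
qed

text \<open>The variables stand for \<open>\<phi>\<^sub>1 = r + i\<i>\<close>, \<open>\<phi>\<^sub>2 = p + q\<i>\<close> and \<open>\<phi>\<^sub>3 = - b + v\<i>\<close>; the coefficients are those of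
  the kernel below. The terms in \<open>\<phi>\<^sub>2\<close> are small and only bounded in absolute value.\<close>

lemma cubic_combination_bound:
  fixes r i p q b v :: real
  assumes "r\<^sup>2 + i\<^sup>2 \<le> (6373/10000)\<^sup>2" "b\<^sup>2 + v\<^sup>2 \<le> (6373/10000)\<^sup>2" "0 \<le> i"
    and "0 \<le> 4 * r - 3 + b"
    and "3 * r - 2 - (4 * r - 3 + b) / 4 \<le> p" "p \<le> 3 * r - 2"
    and "(q - i)\<^sup>2 \<le> 2/5 * (2 * r - 1) * (4 * r - 3 + b)"
    and "v\<^sup>2 \<le> 18/5 * (2 * r - 1) * (4 * r - 3 + b)"
  shows "2640 * (2588/10000)
       \<le> 3023 * (r ^ 3 - 3 * r * i\<^sup>2) + 1214 * (3 * r\<^sup>2 * i - i ^ 3)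
       + 290 * (p ^ 3 - 3 * p * q\<^sup>2) + 845 * (3 * p\<^sup>2 * q - q ^ 3)
       + 625 * (b ^ 3 - 3 * b * v\<^sup>2)"
proof -
  have sq: "r\<^sup>2 \<le> (6373/10000)\<^sup>2" "b\<^sup>2 \<le> (6373/10000)\<^sup>2"
    using assms(1,2) zero_le_power2[of i] zero_le_power2[of v] by linarith+
  have rb: "r \<le> 6373/10000" "b \<le> 6373/10000"
    by (rule power2_le_imp_le[OF sq(1)], simp) (rule power2_le_imp_le[OF sq(2)], simp)
  then have r: "5906/10000 \<le> r" using assms(4) by linarith
  have "(5906/10000)\<^sup>2 \<le> r\<^sup>2" using r by (intro power_mono) auto
  then have i2: "i\<^sup>2 \<le> (2395/10000)\<^sup>2" using assms(1) by (simp add: power2_eq_square)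
  then have i: "i \<le> 2395/10000" by (rule power2_le_imp_le) simp
  \<comment> \<open>The terms containing \<open>i\<close> are collected as \<open>i\<close> times a
    bracket that is at least -85; they cost at most 85 * 0.2395 < 20.4.\<close>
  have "- 22 \<le> 3642 * r - 9069 * i" using r i by linarith
  then have "r * (- 22) \<le> r * (3642 * r - 9069 * i)" using r by (intro mult_left_mono) auto
  moreover have "(2395/10000)\<^sup>2 \<le> (58/1000 :: real)" by (simp add: power2_eq_square)
  ultimately have "- 85 \<le> r * (3642 * r - 9069 * i) - 1214 * i\<^sup>2"
    using rb i2 by linarith
  then have "i * (- 85) \<le> i * (r * (3642 * r - 9069 * i) - 1214 * i\<^sup>2)"
    using assms(3) by (intro mult_left_mono) auto
  moreover have "3023 * r ^ 3 + i * (r * (3642 * r - 9069 * i) - 1214 * i\<^sup>2)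
      = 3023 * (r ^ 3 - 3 * r * i\<^sup>2) + 1214 * (3 * r\<^sup>2 * i - i ^ 3)"
    by algebra
  ultimately have first:
    "3023 * r ^ 3 - 204/10 \<le> 3023 * (r ^ 3 - 3 * r * i\<^sup>2) + 1214 * (3 * r\<^sup>2 * i - i ^ 3)"
    using i by linarith
  \<comment> \<open>\<open>R\<close> and \<open>I\<close> are the real and imaginary parts of
    \<open>(p + iq)^3\<close>. Cauchy-Schwarz against the vector (290, 845), of squared length
    798125, leaves only the modulus of \<open>p + iq\<close>.\<close>
  define R where "R = p ^ 3 - 3 * p * q\<^sup>2"
  define I where "I = 3 * p\<^sup>2 * q - q ^ 3"
  have "p\<^sup>2 + q\<^sup>2 \<le> (38/100)\<^sup>2"
    using second_moment_bound[of r i "4 * r - 3 + b" p q] assms r rb by simp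
  then have "(p\<^sup>2 + q\<^sup>2) ^ 3 \<le> ((38/100)\<^sup>2) ^ 3" by (intro power_mono) auto
  moreover have "R\<^sup>2 + I\<^sup>2 = (p\<^sup>2 + q\<^sup>2) ^ 3" unfolding R_def I_def by algebra
  moreover have "(290 * R + 845 * I)\<^sup>2 + (845 * R - 290 * I)\<^sup>2 = 798125 * (R\<^sup>2 + I\<^sup>2)"
    by algebra
  moreover have "0 \<le> (845 * R - 290 * I)\<^sup>2" by simp
  ultimately have "(290 * R + 845 * I)\<^sup>2 \<le> 798125 * ((38/100)\<^sup>2) ^ 3"
    by argo
  also have "\<dots> \<le> (491/10)\<^sup>2" by (simp add: power2_eq_square power3_eq_cube)
  finally have "\<bar>290 * R + 845 * I\<bar> \<le> \<bar>491/10\<bar>" unfolding abs_le_square_iff .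
  then have second: "- 491/10 \<le> 290 * R + 845 * I" by linarith
  have third: "348/100 - 11/2 * r \<le> b ^ 3 - 3 * b * v\<^sup>2"
    using third_moment_bound[of r b v] assms rb by simp
  \<comment> \<open>The tangent point makes the slope of \<open>3023 * r ^ 3\<close> nearly cancel
    \<open>625 * 11/2\<close>, so the final bound is almost constant in \<open>r\<close>.\<close>
  have "3 * (6156/10000)\<^sup>2 * r - 2 * (6156/10000) ^ 3 \<le> r ^ 3"
    using cube_ge_tangent[of r "6156/10000"] r by simp
  then have "2640 * (2588/10000) \<le> 3023 * r ^ 3 - 204/10 - 491/10 + 625 * (348/100 - 11/2 * r)"
    using r rb by (simp add: power2_eq_square power3_eq_cube)
  with first second third show ?thesis unfolding R_def I_def by argo
qed

section \<open>Trigonometric moments on the arc\<close>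

definition mean :: "'a set \<Rightarrow> ('a \<Rightarrow> real) \<Rightarrow> real" where
  "mean A f = (\<Sum>a\<in>A. f a) / real (card A)"

lemma mean_add: "mean A (\<lambda>a. f a + h a) = mean A f + mean A h"
  by (simp add: mean_def sum.distrib add_divide_distrib)

lemma mean_diff: "mean A (\<lambda>a. f a - h a) = mean A f - mean A h"
  by (simp add: mean_def sum_subtractf diff_divide_distrib)

lemma mean_cmult: "mean A (\<lambda>a. t * f a) = t * mean A f"
  by (simp add: mean_def sum_distrib_left)

lemma mean_const: "finite A \<Longrightarrow> A \<noteq> {} \<Longrightarrow> mean A (\<lambda>a. t) = t"
  by (simp add: mean_def)

lemma mean_mono: "(\<And>a. a \<in> A \<Longrightarrow> f a \<le> h a) \<Longrightarrow> mean A f \<le> mean A h"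
  by (simp add: mean_def divide_right_mono sum_mono)

lemma mean_nonneg: "(\<And>a. a \<in> A \<Longrightarrow> 0 \<le> f a) \<Longrightarrow> 0 \<le> mean A f"
  by (simp add: mean_def sum_nonneg)

lemma discriminant_le_of_nonneg:
  fixes p q r :: real
  assumes "\<And>t. 0 \<le> p - 2 * t * q + t\<^sup>2 * r" "0 \<le> r"
  shows "q\<^sup>2 \<le> r * p"
proof (cases "r = 0")
  case True
  have "q = 0"
  proof (rule ccontr)
    assume "q \<noteq> 0"
    \<comment> \<open>At this \<open>t\<close> the expression equals -1.\<close>
    then show False using assms(1)[of "(p + 1) / (2 * q)"] True by simp
  qed
  with True show ?thesis by simp
next
  case False
  then have "r * (p - 2 * (q / r) * q + (q / r)\<^sup>2 * r) = r * p - q\<^sup>2"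
    by (simp add: field_simps power2_eq_square)
  moreover have "0 \<le> r * (p - 2 * (q / r) * q + (q / r)\<^sup>2 * r)"
    using assms by (intro mult_nonneg_nonneg)
  ultimately show ?thesis by linarith
qed

lemma mean_Cauchy_Schwarz:
  assumes "\<And>a. a \<in> A \<Longrightarrow> 0 \<le> v a"
  shows "(mean A (\<lambda>a. v a * s a))\<^sup>2 \<le> mean A v * mean A (\<lambda>a. v a * (s a)\<^sup>2)"
proof (rule discriminant_le_of_nonneg)
  show "0 \<le> mean A v" using assms by (rule mean_nonneg)
next
  fix t
  have "0 \<le> mean A (\<lambda>a. v a * (s a - t)\<^sup>2)" using assms by (intro mean_nonneg) simp
  also have "(\<lambda>a. v a * (s a - t)\<^sup>2) = (\<lambda>a. v a * (s a)\<^sup>2 - (2 * t) * (v a * s a) + t\<^sup>2 * v a)"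
    by (intro ext) algebra
  finally show "0 \<le> mean A (\<lambda>a. v a * (s a)\<^sup>2) - 2 * t * mean A (\<lambda>a. v a * s a) + t\<^sup>2 * mean A v"
    by (simp only: mean_add mean_diff mean_cmult)
qed

lemma cos_ge_half: "\<bar>x\<bar> \<le> pi / 3 \<Longrightarrow> 1 / 2 \<le> cos x"
  using cos_monotone_0_pi_le[of "\<bar>x\<bar>" "pi / 3"] by (simp add: cos_60)

text \<open>\<open>g\<close> is the mean of a defect \<open>G\<close> that on the arc is nonnegative
  and vanishes only at 0 and \<plusminus>pi/3. The gap for \<open>C 2\<close> shares the factor
  \<open>(1 - c) * (2 * c - 1)\<close> with \<open>G\<close>. Both sin 2X - sin X and sin 3X are
  divisible by \<open>2 * c - 1\<close>, so Cauchy-Schwarz with that weight controls their means by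
  \<open>g\<close>.\<close>

lemma trigonometric_moment_bounds:
  fixes X :: "'a \<Rightarrow> real"
  assumes "finite A" "A \<noteq> {}" and X: "\<And>a. a \<in> A \<Longrightarrow> \<bar>X a\<bar> \<le> pi / 3"
    and C_def: "C = (\<lambda>k. mean A (\<lambda>a. cos (k * X a)))"
    and S_def: "S = (\<lambda>k. mean A (\<lambda>a. sin (k * X a)))"
    and g_def: "g = 4 * C 1 - 3 - C 3"
  shows "0 \<le> g"
    and "3 * C 1 - 2 - g / 4 \<le> C 2" and "C 2 \<le> 3 * C 1 - 2"
    and "(S 2 - S 1)\<^sup>2 \<le> 2/5 * (2 * C 1 - 1) * g"
    and "(S 3)\<^sup>2 \<le> 18/5 * (2 * C 1 - 1) * g"
proof -
  define c where "c = (\<lambda>a. cos (X a))"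
  define s where "s = (\<lambda>a. sin (X a))"
  define G where "G = (\<lambda>a. (1 - c a) * (2 * c a - 1) * (2 * c a + 3))"
  note mean_simps = mean_add mean_diff mean_cmult mean_const[OF assms(1,2)]
  have c: "1 / 2 \<le> c a" "c a \<le> 1" if "a \<in> A" for a
    using cos_ge_half[OF X[OF that]] by (auto simp: c_def)
  have s2: "(s a)\<^sup>2 = (1 - c a) * (1 + c a)" for a
    using sin_squared_eq[of "X a"] by (simp add: s_def c_def power2_eq_square algebra_simps)
  have cos2: "cos (2 * X a) = 2 * (c a)\<^sup>2 - 1" for a
    by (simp add: c_def cos_double_cos)
  have sin2: "sin (2 * X a) = 2 * s a * c a" for a
    by (simp add: s_def c_def sin_double)
  have cos3: "cos (3 * X a) = 4 * c a ^ 3 - 3 * c a" for a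
    by (simp add: c_def cos_treble_cos)
  have sin3: "sin (3 * X a) = s a * (4 * (c a)\<^sup>2 - 1)" for a
  proof -
    have "sin (2 * X a + X a) = 2 * s a * c a * c a + (2 * (c a)\<^sup>2 - 1) * s a"
      unfolding sin_add sin2 cos2 by (simp add: s_def c_def)
    then show ?thesis by (simp add: power2_eq_square algebra_simps)
  qed
  have G0: "0 \<le> G a" if "a \<in> A" for a
    using c[OF that] by (simp add: G_def)
  have C1: "C 1 = mean A c" and S1: "S 1 = mean A s" by (simp_all add: C_def S_def c_def s_def)
  have g: "g = mean A G"
  proof -
    have "G = (\<lambda>a. 4 * c a - 3 - cos (3 * X a))"
      unfolding G_def cos3 by (intro ext) algebra
    then show ?thesis by (simp add: g_def mean_simps C_def c_def)
  qed
  show "0 \<le> g" unfolding g using G0 by (rule mean_nonneg)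
  have gap: "0 \<le> 3 * c a - 2 - cos (2 * X a)" "3 * c a - 2 - cos (2 * X a) \<le> 1/4 * G a"
    if "a \<in> A" for a
  proof -
    have *: "3 * c a - 2 - cos (2 * X a) = (1 - c a) * (2 * c a - 1)" unfolding cos2 by algebra
    have "0 \<le> (1 - c a) * (2 * c a - 1)" using c[OF that] by simp
    moreover from this have "(1 - c a) * (2 * c a - 1) * 4 \<le> G a"
      unfolding G_def using c[OF that] by (intro mult_left_mono) auto
    ultimately show "0 \<le> 3 * c a - 2 - cos (2 * X a)" "3 * c a - 2 - cos (2 * X a) \<le> 1/4 * G a"
      unfolding * by auto
  qed
  have "0 \<le> mean A (\<lambda>a. 3 * c a - 2 - cos (2 * X a))" using gap(1) by (rule mean_nonneg)
  then show "C 2 \<le> 3 * C 1 - 2" by (simp add: mean_simps C_def c_def)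
  have "mean A (\<lambda>a. 3 * c a - 2 - cos (2 * X a)) \<le> mean A (\<lambda>a. 1/4 * G a)"
    using gap(2) by (rule mean_mono)
  moreover have "mean A (\<lambda>a. 1/4 * G a) = 1/4 * g" unfolding g by (rule mean_cmult)
  ultimately show "3 * C 1 - 2 - g / 4 \<le> C 2"
    by (simp add: mean_simps C_def c_def)
  have v0: "0 \<le> 2 * c a - 1" if "a \<in> A" for a using c[OF that] by simp
  have v: "mean A (\<lambda>a. 2 * c a - 1) = 2 * C 1 - 1" by (simp add: mean_simps C1)
  then have W0: "0 \<le> 2 * C 1 - 1" using mean_nonneg[of A "\<lambda>a. 2 * c a - 1"] v0 by simp
  have sG: "(2 * c a - 1) * (s a)\<^sup>2 \<le> 2/5 * G a" if "a \<in> A" for a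
  proof -
    have "(1 - c a) * (2 * c a - 1) * (1 + c a) \<le> (1 - c a) * (2 * c a - 1) * (2/5 * (2 * c a + 3))"
      using c[OF that] by (intro mult_left_mono) auto
    also have "\<dots> = 2/5 * G a" unfolding G_def by algebra
    finally show ?thesis unfolding s2 by (simp add: mult_ac)
  qed
  have "S 2 - S 1 = mean A (\<lambda>a. (2 * c a - 1) * s a)"
  proof -
    have "(\<lambda>a. (2 * c a - 1) * s a) = (\<lambda>a. sin (2 * X a) - s a)"
      unfolding sin2 by (intro ext) algebra
    then show ?thesis by (simp add: mean_simps S_def s_def)
  qed
  then have "(S 2 - S 1)\<^sup>2 \<le> (2 * C 1 - 1) * mean A (\<lambda>a. (2 * c a - 1) * (s a)\<^sup>2)"
    using mean_Cauchy_Schwarz[of A "\<lambda>a. 2 * c a - 1" s] v0 v by simp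
  also have "\<dots> \<le> (2 * C 1 - 1) * mean A (\<lambda>a. 2/5 * G a)"
    using W0 sG by (intro mult_left_mono mean_mono)
  finally show "(S 2 - S 1)\<^sup>2 \<le> 2/5 * (2 * C 1 - 1) * g"
    unfolding mean_cmult g[symmetric] by (simp add: mult_ac)
  have tG: "(2 * c a - 1) * (s a * (2 * c a + 1))\<^sup>2 \<le> 18/5 * G a" if "a \<in> A" for a
  proof -
    have "(2 * c a + 1)\<^sup>2 \<le> 3\<^sup>2" using c[OF that] by (intro power_mono) auto
    then have "(2 * c a - 1) * (s a)\<^sup>2 * (2 * c a + 1)\<^sup>2 \<le> (2 * c a - 1) * (s a)\<^sup>2 * 9"
      using v0[OF that] by (intro mult_left_mono) auto
    moreover have "(2 * c a - 1) * (s a * (2 * c a + 1))\<^sup>2 = (2 * c a - 1) * (s a)\<^sup>2 * (2 * c a + 1)\<^sup>2"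
      by algebra
    ultimately show ?thesis using sG[OF that] by linarith
  qed
  have "S 3 = mean A (\<lambda>a. (2 * c a - 1) * (s a * (2 * c a + 1)))"
  proof -
    have "(\<lambda>a. (2 * c a - 1) * (s a * (2 * c a + 1))) = (\<lambda>a. sin (3 * X a))"
      unfolding sin3 by (intro ext) algebra
    then show ?thesis by (simp add: S_def)
  qed
  then have "(S 3)\<^sup>2 \<le> (2 * C 1 - 1) * mean A (\<lambda>a. (2 * c a - 1) * (s a * (2 * c a + 1))\<^sup>2)"
    using mean_Cauchy_Schwarz[of A "\<lambda>a. 2 * c a - 1" "\<lambda>a. s a * (2 * c a + 1)"] v0 v by simp
  also have "\<dots> \<le> (2 * C 1 - 1) * mean A (\<lambda>a. 18/5 * G a)"
    using W0 tG by (intro mult_left_mono mean_mono)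
  finally show "(S 3)\<^sup>2 \<le> 18/5 * (2 * C 1 - 1) * g"
    unfolding mean_cmult g[symmetric] by (simp add: mult_ac)
qed

section \<open>Representations and kernels\<close>

lemma mset_triple_eqD:
  assumes "{#a, b, c#} = {#x, y, z#}"
  shows "(a, b, c) \<in> {(x, y, z), (x, z, y), (y, x, z), (y, z, x), (z, x, y), (z, y, x)}"
proof -
  have pair: "b = p \<and> c = q \<or> b = q \<and> c = p" if "{#b, c#} = {#p, q#}" for p q
    using that by (auto simp: add_eq_conv_diff)
  have "a \<in># {#a, b, c#}" by simp
  then consider "a = x" | "a = y" | "a = z" unfolding assms by auto
  then show ?thesis
  proof cases
    case 1
    then show ?thesis using assms pair[of y z] by auto
  next
    case 2
    then have "{#b, c#} = {#x, z#}" using assms by (simp add: add_mset_commute[of x y])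
    then show ?thesis using 2 pair by auto
  next
    case 3
    then have "{#b, c#} = {#x, y#}"
      using assms by (simp add: add_mset_commute[of y z] add_mset_commute[of x z])
    then show ?thesis using 3 pair by auto
  qed
qed

lemma card_ordered_representations_le:
  fixes A :: "nat set"
  assumes "finite A" "Bhg_set 3 g A"
  shows "card {t \<in> A \<times> A \<times> A. (case t of (a, b, c) \<Rightarrow> a + b + c) = m} \<le> 6 * g"
proof -
  let ?T = "{t \<in> A \<times> A \<times> A. (case t of (a, b, c) \<Rightarrow> a + b + c) = m}"
  let ?f = "\<lambda>(a, b, c). {#a, b, c#}"
  let ?M = "{M. set_mset M \<subseteq> A \<and> size M = 3 \<and> sum_mset M = m}"
  have fin: "finite ?T" using assms(1) by simp
  have M: "?M = ?f ` ?T"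
  proof (intro equalityI subsetI)
    fix M assume M: "M \<in> ?M"
    then have "size M = Suc 2" by simp
    then obtain a M1 where M1: "M = add_mset a M1" using size_eq_Suc_imp_eq_union by blast
    with M have "size M1 = Suc 1" by simp
    then obtain b M2 where M2: "M1 = add_mset b M2" using size_eq_Suc_imp_eq_union by blast
    with M M1 have "size M2 = 1" by simp
    from size_1_singleton_mset[OF this] obtain c where "M2 = {#c#}" by blast
    with M1 M2 have "M = {#a, b, c#}" by simp
    with M show "M \<in> ?f ` ?T" by (intro image_eqI[of _ _ "(a, b, c)"]) auto
  qed auto
  have fibre: "card {t \<in> ?T. ?f t = M} \<le> 6" if "M \<in> ?f ` ?T" for M :: "nat multiset"
  proof -
    from that obtain x y z where xyz: "M = {#x, y, z#}" by auto
    have "{t \<in> ?T. ?f t = M}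
        \<subseteq> set [(x, y, z), (x, z, y), (y, x, z), (y, z, x), (z, x, y), (z, y, x)]"
      unfolding xyz by (auto dest!: mset_triple_eqD)
    then have "card {t \<in> ?T. ?f t = M}
        \<le> card (set [(x, y, z), (x, z, y), (y, x, z), (y, z, x), (z, x, y), (z, y, x)])"
      by (intro card_mono) auto
    \<comment> \<open>The six permutations may coincide, so only the length of the list is
      used.\<close>
    also have "\<dots> \<le> 6" by (rule order_trans[OF card_length]) simp
    finally show ?thesis .
  qed
  have "card ?T = (\<Sum>M\<in>?f ` ?T. card {t \<in> ?T. ?f t = M})"
    using sum.group[of ?T "?f ` ?T" ?f "\<lambda>_. 1 :: nat"] fin by simp
  also have "\<dots> \<le> (\<Sum>M\<in>?f ` ?T. 6)" using fibre by (intro sum_mono)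
  also have "\<dots> = 6 * card ?M" by (simp add: M)
  also have "\<dots> \<le> 6 * g" using assms(2) by (simp add: Bhg_set_def)
  finally show ?thesis .
qed

section \<open>Placing the sums on the circle\<close>

definition angle :: "nat \<Rightarrow> nat \<Rightarrow> real" where
  "angle N a = pi * (2 * real a - real N - 1) / (3 * real N)"

text \<open>The spacing is 2 pi/(3N), so \<open>m\<close> from 1 to \<open>3 * N\<close> runs
  through a rotated copy of the 3N-th roots of unity.\<close>

definition sum_angle :: "nat \<Rightarrow> nat \<Rightarrow> real" where
  "sum_angle N m = pi * (2 * real m - 3 * real N - 3) / (3 * real N)"

lemma sum_angle_add: "sum_angle N (a + b + c) = angle N a + angle N b + angle N c"
  unfolding angle_def sum_angle_def add_divide_distrib[symmetric] by (simp add: algebra_simps)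

lemma abs_angle_le:
  assumes "a \<in> {1..N}"
  shows "\<bar>angle N a\<bar> \<le> pi / 3"
proof -
  have "\<bar>2 * real a - real N - 1\<bar> \<le> real N" using assms by auto
  then have "pi * \<bar>2 * real a - real N - 1\<bar> / (3 * real N) \<le> pi * real N / (3 * real N)"
    by (intro divide_right_mono mult_left_mono) auto
  moreover have "\<bar>angle N a\<bar> = pi * \<bar>2 * real a - real N - 1\<bar> / (3 * real N)"
    by (simp add: angle_def abs_mult)
  ultimately show ?thesis using assms by simp
qed

text \<open>A geometric sum with ratio a 3N-th root of unity. The bound on \<open>k\<close> puts its
  argument strictly between 0 and pi, hence the ratio is not 1.\<close>

lemma sum_cis_sum_angle_eq_0:
  assumes "0 < k" "2 * k < 3 * N"
  shows "(\<Sum>m\<in>{1..3 * N}. cis (real k * sum_angle N m)) = 0"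
proof -
  define \<zeta> where "\<zeta> = cis (2 * pi * real k / (3 * real N))"
  have N: "0 < real N" using assms by auto
  have "0 < 2 * pi * real k / (3 * real N)" using assms N by simp
  moreover have "2 * pi * real k / (3 * real N) < pi"
  proof -
    have "pi * (2 * real k) < pi * (3 * real N)"
      using assms(2) by (intro mult_strict_left_mono) (auto simp flip: of_nat_mult of_nat_less_iff)
    then show ?thesis using N by (simp add: field_simps)
  qed
  ultimately have "0 < sin (2 * pi * real k / (3 * real N))" by (rule sin_gt_zero)
  then have "\<zeta> \<noteq> 1" unfolding \<zeta>_def by (auto simp: complex_eq_iff)
  moreover have "\<zeta> ^ (3 * N) = 1"
  proof -
    have "\<zeta> ^ (3 * N) = cis (2 * pi * real k)"
      unfolding \<zeta>_def DeMoivre using N by (simp add: field_simps)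
    then show ?thesis by simp
  qed
  ultimately have geo: "(\<Sum>m<3 * N. \<zeta> ^ m) = 0" by (simp add: geometric_sum)
  have "cis (real k * sum_angle N (Suc m))
      = cis (real k * (pi * (- 3 * real N - 1) / (3 * real N))) * \<zeta> ^ m" for m
  proof -
    have "real k * sum_angle N (Suc m)
        = real k * (pi * (- 3 * real N - 1) / (3 * real N)) + real m * (2 * pi * real k / (3 * real N))"
      using N by (simp add: sum_angle_def field_simps)
    then show ?thesis unfolding \<zeta>_def DeMoivre cis_mult by simp
  qed
  then show ?thesis
    using geo by (simp add: sum.atLeast1_atMost_eq sum_distrib_left[symmetric])
qed

section \<open>From exponential sums to kernel inequalities\<close>

lemma sum_cis_power3:
  "(\<Sum>a\<in>A. cis (t * angle N a)) ^ 3
    = (\<Sum>(a, b, c)\<in>A \<times> A \<times> A. cis (t * sum_angle N (a + b + c)))"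
proof -
  have "(\<Sum>(a, b, c)\<in>A \<times> A \<times> A. cis (t * sum_angle N (a + b + c)))
      = (\<Sum>a\<in>A. \<Sum>b\<in>A. \<Sum>c\<in>A. cis (t * angle N a) * (cis (t * angle N b) * cis (t * angle N c)))"
    unfolding sum_angle_add by (simp add: sum.cartesian_product distrib_left cis_mult add.assoc)
  also have "\<dots> = (\<Sum>a\<in>A. cis (t * angle N a)) ^ 3"
    by (simp only: sum_distrib_left[symmetric] sum_distrib_right[symmetric] power3_eq_cube mult.assoc)
  finally show ?thesis by simp
qed

text \<open>The left side is the sum of the kernel over all ordered triples. Grouping by the sum and
  using nonnegativity bounds it by \<open>6 * g\<close> times the kernel total over the circle,
  where only the constant term survives and gives \<open>3 * N\<close>.\<close>

lemma nonneg_kernel_inequality: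
  fixes u :: "nat \<Rightarrow> complex"
  assumes N: "3 \<le> N" and A: "A \<subseteq> {1..N}" and "Bhg_set 3 g A"
    and nonneg: "\<And>x. 0 \<le> 1 + Re (\<Sum>k\<in>{1..3}. u k * cis (real k * x))"
  shows "real (card A) ^ 3 + Re (\<Sum>k\<in>{1..3}. u k * (\<Sum>a\<in>A. cis (real k * angle N a)) ^ 3)
    \<le> 18 * real g * real N"
proof -
  define w where "w = (\<lambda>x. 1 + Re (\<Sum>k\<in>{1..3}. u k * cis (real k * x)))"
  let ?T = "A \<times> A \<times> A" and ?s = "\<lambda>(a, b, c). a + b + c :: nat"
  have fin: "finite A" using A by (rule finite_subset) simp
  have range: "1 \<le> a \<and> a \<le> N" if "a \<in> A" for a using A that by auto
  have "real (card A) ^ 3 + Re (\<Sum>k\<in>{1..3}. u k * (\<Sum>a\<in>A. cis (real k * angle N a)) ^ 3)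
      = (\<Sum>t\<in>?T. w (sum_angle N (?s t)))"
  proof -
    have "(\<Sum>k\<in>{1..3}. u k * (\<Sum>a\<in>A. cis (real k * angle N a)) ^ 3)
        = (\<Sum>t\<in>?T. \<Sum>k\<in>{1..3}. u k * cis (real k * sum_angle N (?s t)))"
      unfolding sum_cis_power3 sum_distrib_left
      by (subst sum.swap) (simp add: case_prod_unfold)
    moreover have "real (card A) ^ 3 = (\<Sum>t\<in>?T. 1)"
      using fin by (simp add: card_cartesian_product power3_eq_cube)
    ultimately show ?thesis unfolding w_def sum.distrib by (simp only: Re_sum)
  qed
  \<comment> \<open>The values 1 and 2 are never attained as sums; they are included to complete the
    circle.\<close>
  also have "\<dots> = (\<Sum>m\<in>{1..3 * N}. \<Sum>t\<in>{t \<in> ?T. ?s t = m}. w (sum_angle N (?s t)))"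
    using fin by (intro sum.group[symmetric]) (auto dest!: range)
  also have "\<dots> = (\<Sum>m\<in>{1..3 * N}. real (card {t \<in> ?T. ?s t = m}) * w (sum_angle N m))"
    by (intro sum.cong) auto
  also have "\<dots> \<le> (\<Sum>m\<in>{1..3 * N}. real (6 * g) * w (sum_angle N m))"
    using card_ordered_representations_le[OF fin assms(3)] nonneg
    by (intro sum_mono mult_right_mono) (auto simp only: w_def of_nat_le_iff)
  also have "\<dots> = real (6 * g) * (\<Sum>m\<in>{1..3 * N}. w (sum_angle N m))"
    by (simp only: sum_distrib_left)
  also have "(\<Sum>m\<in>{1..3 * N}. w (sum_angle N m)) = 3 * real N"
  proof -
    have "(\<Sum>m\<in>{1..3 * N}. \<Sum>k\<in>{1..3}. u k * cis (real k * sum_angle N m))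
        = (\<Sum>k\<in>{1..3}. u k * (\<Sum>m\<in>{1..3 * N}. cis (real k * sum_angle N m)))"
      by (subst sum.swap) (simp only: sum_distrib_left)
    also have "\<dots> = 0" using N by (intro sum.neutral ballI) (subst sum_cis_sum_angle_eq_0, auto)
    finally show ?thesis unfolding w_def sum.distrib by (simp flip: Re_sum)
  qed
  finally show ?thesis by simp
qed

text \<open>The kernel is 1 plus one cosine, with its phase aligned to the cubed exponential sum so
  that the gain is the full modulus.\<close>

lemma single_frequency_inequality:
  assumes "3 \<le> N" "A \<subseteq> {1..N}" "Bhg_set 3 g A" and k: "k \<in> {1..3}"
  shows "real (card A) ^ 3 + cmod (\<Sum>a\<in>A. cis (real k * angle N a)) ^ 3 \<le> 18 * real g * real N"
proof -
  define z where "z = (\<Sum>a\<in>A. cis (real k * angle N a)) ^ 3"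
  define u where "u = (\<lambda>j. if j = k then cnj (sgn z) else 0)"
  have u: "(\<Sum>j\<in>{1..3}. u j * f j) = cnj (sgn z) * f k" for f
  proof -
    have "(\<Sum>j\<in>{1..3}. u j * f j) = (\<Sum>j\<in>{1..3}. if k = j then cnj (sgn z) * f j else 0)"
      by (intro sum.cong) (auto simp: u_def)
    then show ?thesis using k by simp
  qed
  have "0 \<le> 1 + Re (\<Sum>j\<in>{1..3}. u j * cis (real j * x))" for x
  proof -
    have "\<bar>Re (cnj (sgn z) * cis (real k * x))\<bar> \<le> 1"
      by (rule order_trans[OF abs_Re_le_cmod]) (simp add: norm_mult norm_sgn)
    then show ?thesis unfolding u by linarith
  qed
  from nonneg_kernel_inequality[OF assms(1-3) this]
  have "real (card A) ^ 3 + Re (cnj (sgn z) * z) \<le> 18 * real g * real N"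
    unfolding u z_def .
  moreover have "Re (cnj (sgn z) * z) = cmod z"
  proof -
    have "cnj (sgn z) * z = of_real (cmod z)"
      by (cases "z = 0")
        (simp_all add: sgn_eq mult.commute[of "cnj z"] complex_norm_square[symmetric]
          power2_eq_square)
    then show ?thesis by simp
  qed
  ultimately show ?thesis by (simp add: z_def norm_power)
qed

text \<open>The two double zeros of the kernel approximate those of the numerically optimal one; they
  are placed at Pythagorean angles to keep the coefficients rational. The sign \<open>e\<close> reflects it.\<close>

lemma trigonometric_kernel_nonneg:
  fixes x e :: real
  assumes "e\<^sup>2 = 1"
  shows "0 \<le> 2640 + 3023 * cos x + 1214 * e * sin x + 290 * cos (2 * x) + 845 * e * sin (2 * x)
    - 625 * cos (3 * x)"
proof -
  define c where "c = cos x"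
  define s where "s = e * sin x"
  have cs: "c\<^sup>2 + s\<^sup>2 = 1" using assms by (simp add: c_def s_def power_mult_distrib)
  have c1: "\<bar>c\<bar> \<le> 1" and s1: "\<bar>s\<bar> \<le> 1"
    unfolding abs_square_le_1[symmetric] using cs zero_le_power2[of c] zero_le_power2[of s]
    by linarith+
  \<comment> \<open>The unit vector \<open>(c, s)\<close> rotated and scaled by 5, so each
    coordinate is at most 5 in absolute value. This makes the first two factors below nonnegative;
    the third is at least 170 - 96 - 28.\<close>
  have "(4 * c - 3 * s)\<^sup>2 + (3 * c + 4 * s)\<^sup>2 = 25" using cs by algebra
  then have "(4 * c - 3 * s)\<^sup>2 \<le> 25" "(3 * c + 4 * s)\<^sup>2 \<le> 25"
    using zero_le_power2[of "4 * c - 3 * s"] zero_le_power2[of "3 * c + 4 * s"] by linarith+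
  then have "\<bar>4 * c - 3 * s\<bar> \<le> 5" "\<bar>3 * c + 4 * s\<bar> \<le> 5"
    using abs_le_square_iff[of "4 * c - 3 * s" 5] abs_le_square_iff[of "3 * c + 4 * s" 5] by simp_all
  then have "0 \<le> (5 + 4 * c - 3 * s) * (5 + 3 * c + 4 * s) * (170 - 96 * c + 28 * s)"
    using c1 s1 by (intro mult_nonneg_nonneg) linarith+
  also have "\<dots> = 2640 + 3023 * c + 1214 * s + 290 * (2 * c\<^sup>2 - 1) + 845 * (2 * s * c)
      - 625 * (4 * c ^ 3 - 3 * c)"
    using cs by algebra
  also have "\<dots> = 2640 + 3023 * cos x + 1214 * e * sin x + 290 * cos (2 * x) + 845 * e * sin (2 * x)
      - 625 * cos (3 * x)"
    unfolding cos_double_cos sin_double cos_treble_cos c_def s_def by algebra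
  finally show ?thesis .
qed

section \<open>Combining the two kinds of kernel\<close>

lemma B3g_card_cube_bound:
  assumes N: "3 \<le> N" and A: "A \<subseteq> {1..N}" and B: "Bhg_set 3 g A"
  shows "(1 + 2588/10000) * real (card A) ^ 3 \<le> 18 * real g * real N"
proof (cases "A = {}")
  case False
  have fin: "finite A" using A by (rule finite_subset) simp
  define C where "C = (\<lambda>k. mean A (\<lambda>a. cos (k * angle N a)))"
  define S where "S = (\<lambda>k. mean A (\<lambda>a. sin (k * angle N a)))"
  define n where "n = real (card A)"
  have n: "0 < n" using fin False by (simp add: n_def card_gt_0_iff)
  have sums: "(\<Sum>a\<in>A. cis (k * angle N a)) = of_real n * Complex (C k) (S k)" for k
    using n by (simp add: complex_eq_iff C_def S_def mean_def n_def)
  \<comment> \<open>0.6373 is the cube root of 0.2588, rounded up.\<close>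
  have large: ?thesis if "k \<in> {1..3}" and "(6373/10000)\<^sup>2 \<le> (C (real k))\<^sup>2 + (S (real k))\<^sup>2" for k
  proof -
    have "6373/10000 \<le> cmod (Complex (C (real k)) (S (real k)))"
      unfolding cmod_def using that(2) by (intro real_le_rsqrt) simp
    then have "(6373/10000) ^ 3 \<le> cmod (Complex (C (real k)) (S (real k))) ^ 3"
      by (intro power_mono) auto
    then have "2588/10000 \<le> cmod (Complex (C (real k)) (S (real k))) ^ 3"
      by (simp add: power3_eq_cube)
    then have "n ^ 3 * (2588/10000) \<le> n ^ 3 * cmod (Complex (C (real k)) (S (real k))) ^ 3"
      using n by (intro mult_left_mono) auto
    moreover have "n ^ 3 + n ^ 3 * cmod (Complex (C (real k)) (S (real k))) ^ 3 \<le> 18 * real g * real N"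
      using single_frequency_inequality[OF N A B that(1)] n
      unfolding sums by (simp add: norm_mult power_mult_distrib n_def)
    ultimately show ?thesis unfolding n_def by argo
  qed
  show ?thesis
  proof (cases "(6373/10000)\<^sup>2 \<le> (C 1)\<^sup>2 + (S 1)\<^sup>2 \<or> (6373/10000)\<^sup>2 \<le> (C 3)\<^sup>2 + (S 3)\<^sup>2")
    case True
    then show ?thesis using large[of 1] large[of 3] by auto
  next
    case False
    \<comment> \<open>The kernel is reflected when \<open>S 1\<close> is negative, so that its sine
      terms meet \<open>e * S 1 \<ge> 0\<close>.\<close>
    define e where "e = (if 0 \<le> S 1 then 1 else - 1 :: real)"
    have e: "e\<^sup>2 = 1" and eS: "0 \<le> e * S 1" by (auto simp: e_def)
    \<comment> \<open>The kernel is normalised to constant term 1; the imaginary parts are negated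
      because the real part of \<open>u * cis x\<close> contains
      \<open>- Im u * sin x\<close>.\<close>
    define u where "u = (\<lambda>k::nat. if k = 1 then Complex (3023/2640) (- 1214 * e/2640)
      else if k = 2 then Complex (290/2640) (- 845 * e/2640) else Complex (- 625/2640) 0)"
    have u: "(\<Sum>k\<in>{1..3}. u k * f k) = u 1 * f 1 + u 2 * f 2 + u 3 * f 3" for f
      by (simp add: numeral_3_eq_3 numeral_2_eq_2)
    have kernel: "0 \<le> 1 + Re (\<Sum>k\<in>{1..3}. u k * cis (real k * x))" for x
    proof -
      have "1 + Re (\<Sum>k\<in>{1..3}. u k * cis (real k * x)) = (2640 + 3023 * cos x + 1214 * e * sin x
          + 290 * cos (2 * x) + 845 * e * sin (2 * x) - 625 * cos (3 * x)) / 2640"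
        unfolding u by (simp add: u_def field_simps)
      then show ?thesis using trigonometric_kernel_nonneg[OF e, of x] by simp
    qed
    have X: "\<bar>angle N a\<bar> \<le> pi / 3" if "a \<in> A" for a using abs_angle_le A that by blast
    note mb = trigonometric_moment_bounds[OF fin \<open>A \<noteq> {}\<close> X C_def S_def refl]
    have cube: "Re (Complex p q * Complex x y ^ 3)
        = p * (x ^ 3 - 3 * x * y\<^sup>2) - q * (3 * x\<^sup>2 * y - y ^ 3)" for p q x y
      by (simp add: power3_eq_cube power2_eq_square algebra_simps)
    have bound: "2640 * (2588/10000)
       \<le> 3023 * (C 1 ^ 3 - 3 * C 1 * (e * S 1)\<^sup>2) + 1214 * (3 * (C 1)\<^sup>2 * (e * S 1) - (e * S 1) ^ 3)
       + 290 * (C 2 ^ 3 - 3 * C 2 * (e * S 2)\<^sup>2) + 845 * (3 * (C 2)\<^sup>2 * (e * S 2) - (e * S 2) ^ 3)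
       + 625 * ((- C 3) ^ 3 - 3 * (- C 3) * (S 3)\<^sup>2)"
    proof (rule cubic_combination_bound)
      have "(e * S 2 - e * S 1)\<^sup>2 = e\<^sup>2 * (S 2 - S 1)\<^sup>2" by algebra
      then show "(e * S 2 - e * S 1)\<^sup>2 \<le> 2/5 * (2 * C 1 - 1) * (4 * C 1 - 3 + - C 3)"
        using mb(4) e by simp
    qed (use False eS e mb in \<open>auto simp: power_mult_distrib\<close>)
    have e3: "e ^ 3 = e" using e by (simp add: power3_eq_cube power2_eq_square)
    have u123: "u 1 = Complex (3023/2640) (- 1214 * e/2640)"
      "u 2 = Complex (290/2640) (- 845 * e/2640)" "u 3 = Complex (- 625/2640) 0"
      by (simp_all add: u_def)
    have "2588/10000 \<le> Re (u 1 * Complex (C 1) (S 1) ^ 3) + Re (u 2 * Complex (C 2) (S 2) ^ 3)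
        + Re (u 3 * Complex (C 3) (S 3) ^ 3)"
      using bound unfolding u123 cube by (simp add: power_mult_distrib e e3 field_simps)
    then have "n ^ 3 * (2588/10000) \<le> n ^ 3 * (Re (u 1 * Complex (C 1) (S 1) ^ 3)
        + Re (u 2 * Complex (C 2) (S 2) ^ 3) + Re (u 3 * Complex (C 3) (S 3) ^ 3))"
      using n by (intro mult_left_mono) auto
    also have "\<dots> = Re (\<Sum>k\<in>{1..3}. u k * (\<Sum>a\<in>A. cis (real k * angle N a)) ^ 3)"
    proof -
      have "Re (u k * (of_real n * z) ^ 3) = n ^ 3 * Re (u k * z ^ 3)" for k z
        by (simp add: power_mult_distrib algebra_simps flip: of_real_power)
      then show ?thesis unfolding u sums by (simp add: distrib_left)
    qed
    finally show ?thesis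
      using nonneg_kernel_inequality[OF N A B kernel] unfolding n_def by argo
  qed
qed simp

theorem theorem1p1:
  fixes g :: nat
  assumes "g \<ge> 2"
  shows "\<exists>N0::nat. \<forall>N\<ge>N0. \<forall>A. A \<subseteq> {1..N} \<longrightarrow> Bhg_set 3 g A \<longrightarrow>
           real (card A) < (14.3 * real g * real N) powr (1/3)"
proof (intro exI[of _ 3] allI impI)
  fix N A assume N: "3 \<le> N" and A: "A \<subseteq> {1..N}" "Bhg_set 3 g A"
  have pos: "0 < real g * real N" using assms N by simp
  have "(1 + 2588/10000) * real (card A) ^ 3 \<le> 18 * (real g * real N)"
    using B3g_card_cube_bound[OF N A] by simp
  \<comment> \<open>18/1.2588 is just below 14.3, and positivity of \<open>g * N\<close> makes the
    inequality strict.\<close>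
  then have "real (card A) ^ 3 < 143/10 * (real g * real N)" using pos by argo
  then have "(real (card A) ^ 3) powr (1/3) < (14.3 * real g * real N) powr (1/3)"
    by (intro powr_less_mono2) auto
  moreover have "(real (card A) ^ 3) powr (1/3) = real (card A)"
  proof (cases "card A = 0")
    case False
    then have "real (card A) ^ 3 = real (card A) powr 3" by simp
    then show ?thesis using False by (simp only: powr_powr) simp
  qed simp
  ultimately show "real (card A) < (14.3 * real g * real N) powr (1/3)" by simp
qed

end
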